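(* Let $n>1$ and let $X=\{x_0>x_1>\cdots>x_{n-1}\}$ be a linear L-algebra with $n$ elements. If $X$ is simple, then $X$ is isomorphic to $\mathbf A_n$.
   Context: An L-algebra is a set $X$ with a binary operation $\cdot$ and a distinguished element $1$ such that for all $x,y,z\in X$: $1\cdot x=x$ and $x\cdot 1=x\cdot x=1$; $(x\cdot y)\cdot(x\cdot z)=(y\cdot x)\cdot(y\cdot z)$; and $x\cdot y=y\cdot x=1$ implies $x=y$. It is partially ordered by $x\le y\iff x\cdot y=1$; it is linear if this order is total. An ideal of $X$ is a nonempty subset $I\subseteq X$ such that for all $x\in I$, $y\in X$: (I1) $x\cdot y\in I$ implies $y\in I$; (I2) $y\cdot x\in I$; (I3) $(x\cdot y)\cdot y\in I$; (I4) $y\cdot(x\cdot y)\in I$. $X$ is simple if it has no ideals other than $\{1\}$ and $X$. $\mathbf A_n$ is the L-algebra on the $n$-element set $\{a_0,\dots,a_{n-1}\}$ with $1=a_0$ and $a_i\cdot a_j=a_{\max(j-i,0)}$. *)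

theory Defs
  imports Main
begin

locale L_algebra =
  fixes X :: "'a set" and mul :: "'a \<Rightarrow> 'a \<Rightarrow> 'a" and one :: 'a
  assumes one_closed: "one \<in> X"
    and mul_closed: "\<lbrakk>x \<in> X; y \<in> X\<rbrakk> \<Longrightarrow> mul x y \<in> X"
    and one_mul: "x \<in> X \<Longrightarrow> mul one x = x"
    and mul_one: "x \<in> X \<Longrightarrow> mul x one = one"
    and mul_self: "x \<in> X \<Longrightarrow> mul x x = one"
    and cycloid: "\<lbrakk>x \<in> X; y \<in> X; z \<in> X\<rbrakk>
      \<Longrightarrow> mul (mul x y) (mul x z) = mul (mul y x) (mul y z)"
    and antisym: "\<lbrakk>x \<in> X; y \<in> X; mul x y = one; mul y x = one\<rbrakk> \<Longrightarrow> x = y"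

definition L_le :: "('a \<Rightarrow> 'a \<Rightarrow> 'a) \<Rightarrow> 'a \<Rightarrow> 'a \<Rightarrow> 'a \<Rightarrow> bool" where
  "L_le mul one x y \<longleftrightarrow> mul x y = one"

locale linear_L_algebra = L_algebra +
  assumes total: "totalp_on X (L_le mul one)"

definition L_ideal :: "'a set \<Rightarrow> ('a \<Rightarrow> 'a \<Rightarrow> 'a) \<Rightarrow> 'a set \<Rightarrow> bool" where
  "L_ideal X mul I \<longleftrightarrow> I \<noteq> {} \<and> I \<subseteq> X \<and>
    (\<forall>x\<in>I. \<forall>y\<in>X.
      (mul x y \<in> I \<longrightarrow> y \<in> I) \<and>
      mul y x \<in> I \<and>
      mul (mul x y) y \<in> I \<and>
      mul y (mul x y) \<in> I)"

definition L_simple :: "'a set \<Rightarrow> ('a \<Rightarrow> 'a \<Rightarrow> 'a) \<Rightarrow> 'a \<Rightarrow> bool" where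
  "L_simple X mul one \<longleftrightarrow> (\<forall>I. L_ideal X mul I \<longrightarrow> I = {one} \<or> I = X)"

definition L_isomorphic ::
  "'a set \<Rightarrow> ('a \<Rightarrow> 'a \<Rightarrow> 'a) \<Rightarrow> 'a \<Rightarrow> 'b set \<Rightarrow> ('b \<Rightarrow> 'b \<Rightarrow> 'b) \<Rightarrow> 'b \<Rightarrow> bool" where
  "L_isomorphic X mul one Y mul' one' \<longleftrightarrow>
    (\<exists>f. bij_betw f X Y \<and> f one = one' \<and> (\<forall>x\<in>X. \<forall>y\<in>X. f (mul x y) = mul' (f x) (f y)))"

text \<open>The element \<open>a\<^sub>i\<close> of the algebra \<open>A\<^sub>n\<close> is encoded as the natural number \<open>i\<close>. Subtraction on
  \<^typ>\<open>nat\<close> truncates at 0, so \<open>j - i\<close> is \<open>max (j - i) 0\<close>. The unit is \<open>a\<^sub>0\<close>.\<close>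

definition A_carrier :: "nat \<Rightarrow> nat set" where
  "A_carrier n = {..<n}"

definition A_mul :: "nat \<Rightarrow> nat \<Rightarrow> nat" where
  "A_mul i j = j - i"

lemma L_algebra_A: "n \<ge> 1 \<Longrightarrow> linear_L_algebra (A_carrier n) A_mul 0"
  by unfold_locales (auto simp: A_carrier_def A_mul_def L_le_def totalp_on_def)

end

(*
  Index the chain as x_0 > x_1 > ... and write f(i,j) for the index of x_i . x_j. For i <= j the
  cycloid law reads f(f(i,j), f(i,k)) = f(j,k), so f(i,_) is strictly increasing on {i,...,n-1} and,
  by finiteness, f(i,j) <= j. In particular f(1,_) starts at f(1,1) = 0 and skips at most one value:
  there is a t >= 1 with f(1,j) = j - 1 for 1 <= j <= t and f(1,j) = j for j > t. Iterating the
  cycloid law with i = 1 gives f(j,k) = k - j for j <= k <= t and f(j,k) = k for j <= t < k. From this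
  {x_0,...,x_t} is an ideal other than {1}, so t = n - 1 by simplicity, which is the table of A_n.
*)
theory Submission
  imports Defs
begin

context L_algebra
begin

lemma le_trans:
  assumes "x \<in> X" "y \<in> X" "z \<in> X" "mul x y = one" "mul y z = one"
  shows "mul x z = one"
  using cycloid[of x y z] assms by (simp add: one_mul mul_one mul_closed)

end

text \<open>Ideals pull back to ideals along a bijective homomorphism, so simplicity may be tested
  on a copy of the algebra living on indices.\<close>

lemma L_simple_image:
  assumes bij: "bij_betw f X Y"
    and closed: "\<And>x y. x \<in> X \<Longrightarrow> y \<in> X \<Longrightarrow> mul x y \<in> X"
    and hom: "\<And>x y. x \<in> X \<Longrightarrow> y \<in> X \<Longrightarrow> f (mul x y) = mul' (f x) (f y)"
    and simple: "L_simple X mul one"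
  shows "L_simple Y mul' (f one)"
  unfolding L_simple_def
proof (intro allI impI)
  fix J assume J: "L_ideal Y mul' J"
  define I where "I = {x \<in> X. f x \<in> J}"
  have Y: "Y = f ` X" using bij by (simp add: bij_betw_def)
  have "J \<subseteq> Y" and "J \<noteq> {}" using J by (auto simp: L_ideal_def)
  then have image: "f ` I = J" unfolding I_def Y by auto
  have "L_ideal X mul I"
    unfolding L_ideal_def
  proof (intro conjI ballI)
    show "I \<noteq> {}" using image \<open>J \<noteq> {}\<close> by auto
    show "I \<subseteq> X" by (auto simp: I_def)
  qed (use J in \<open>auto simp: L_ideal_def I_def closed hom Y\<close>)
  then have "I = {one} \<or> I = X" using simple by (simp add: L_simple_def)
  then show "J = {f one} \<or> J = Y" using image Y by auto
qed

text \<open>Indices run down the chain: the unit is \<open>0\<close>, and a larger index stands for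
  a smaller element, which reverses the inequality in \<open>eq_0_iff\<close>.\<close>

locale chain_L_algebra = L_algebra "{..<n}" f 0
  for n :: nat and f :: "nat \<Rightarrow> nat \<Rightarrow> nat" +
  assumes eq_0_iff: "i < n \<Longrightarrow> j < n \<Longrightarrow> f i j = 0 \<longleftrightarrow> j \<le> i"
begin

lemma less_n: "i < n \<Longrightarrow> j < n \<Longrightarrow> f i j < n"
  using mul_closed by simp

lemma f_0: "j < n \<Longrightarrow> f 0 j = j"
  using one_mul by simp

text \<open>Here \<open>f j i\<close> is the unit, so one side of the cycloid law collapses. Row
  \<open>j\<close> is thereby determined by any earlier row \<open>i\<close>.\<close>

lemma translate:
  assumes "i \<le> j" "j < n" "k < n"
  shows "f (f i j) (f i k) = f j k"
proof -
  have "f j i = 0" using assms by (simp add: eq_0_iff)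
  then show ?thesis using cycloid[of i j k] assms by (simp add: f_0 less_n)
qed

lemma strict:
  assumes "i \<le> j" "j < k" "k < n"
  shows "f i j < f i k"
proof (rule ccontr)
  assume "\<not> f i j < f i k"
  then have "f (f i j) (f i k) = 0" using assms by (simp add: eq_0_iff less_n)
  then show False using translate[of i j k] assms eq_0_iff[of j k] by simp
qed

lemma growth:
  assumes "i \<le> j" "j \<le> k" "k < n"
  shows "f i j + (k - j) \<le> f i k"
  using assms(2,3)
proof (induction k rule: dec_induct)
  case (step k)
  then show ?case using strict[of i k "Suc k"] assms(1) by simp
qed simp

text \<open>Strict growth from column \<open>j\<close> to the last column must fit below
  \<open>n\<close>; a value above \<open>j\<close> would leave too little room.\<close>

lemma f_le:
  assumes "i < n" "j < n"
  shows "f i j \<le> j"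
proof (cases "i \<le> j")
  case True
  then show ?thesis
    using growth[of i j "n - 1"] less_n[of i "n - 1"] assms by linarith
next
  case False
  then show ?thesis using assms eq_0_iff[of i j] by simp
qed

lemma below_threshold:
  assumes "\<And>j. 1 \<le> j \<Longrightarrow> j \<le> t \<Longrightarrow> f 1 j = j - 1" "t < n" "i \<le> j" "j \<le> t"
  shows "f i j = j - i"
  using assms(3,4)
proof (induction i arbitrary: j)
  case 0
  then show ?case using \<open>t < n\<close> by (simp add: f_0)
next
  case (Suc i)
  \<comment> \<open>Row \<open>1\<close> lowers both indices by one, so \<open>translate\<close>
    reduces row \<open>Suc i\<close> to row \<open>i\<close>.\<close>
  have "f i (j - 1) = f (f 1 (Suc i)) (f 1 j)" using Suc.prems assms(1) by simp
  also have "\<dots> = f (Suc i) j" using Suc.prems \<open>t < n\<close> by (intro translate) auto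
  finally show ?case using Suc.IH[of "j - 1"] Suc.prems by simp
qed

lemma above_threshold:
  assumes "\<And>j. 1 \<le> j \<Longrightarrow> j \<le> t \<Longrightarrow> f 1 j = j - 1" "\<And>j. t < j \<Longrightarrow> j < n \<Longrightarrow> f 1 j = j"
    "i \<le> t" "t < j" "j < n"
  shows "f i j = j"
  using assms(3)
proof (induction i)
  case 0
  then show ?case using \<open>j < n\<close> by (simp add: f_0)
next
  case (Suc i)
  \<comment> \<open>Row \<open>1\<close> lowers the row index but fixes the column \<open>j\<close>
    beyond \<open>t\<close>.\<close>
  have "f i j = f (f 1 (Suc i)) (f 1 j)" using Suc.prems assms by simp
  also have "\<dots> = f (Suc i) j" using Suc.prems assms by (intro translate) auto
  finally show ?case using Suc by simp
qed

text \<open>(I1) holds because rows up to \<open>t\<close> fix every column beyond \<open>t\<close>,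
  and (I2) follows from \<open>f_le\<close>. In (I3) a column \<open>j\<close> beyond
  \<open>t\<close> gives \<open>f j j = 0\<close>; in (I4) \<open>f_le\<close> makes the product
  \<open>0\<close>.\<close>

lemma threshold_ideal:
  assumes "\<And>j. 1 \<le> j \<Longrightarrow> j \<le> t \<Longrightarrow> f 1 j = j - 1" "\<And>j. t < j \<Longrightarrow> j < n \<Longrightarrow> f 1 j = j" "t < n"
  shows "L_ideal {..<n} f {..t}"
  unfolding L_ideal_def
proof (intro conjI ballI impI)
  fix i j assume "i \<in> {..t}" "j \<in> {..<n}"
  then have ij: "i \<le> t" "j < n" "i < n" using \<open>t < n\<close> by auto
  note above = above_threshold[OF assms(1,2) ij(1) _ ij(2)]
  show "j \<in> {..t}" if "f i j \<in> {..t}" using that above by force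
  show "f j i \<in> {..t}" using f_le[of j i] ij by simp
  show "f (f i j) j \<in> {..t}"
  proof (cases "j \<le> t")
    case True
    then show ?thesis using f_le[of "f i j" j] ij less_n[of i j] by simp
  next
    case False
    then show ?thesis using above ij eq_0_iff[of j j] by simp
  qed
  show "f j (f i j) \<in> {..t}"
    using f_le[of i j] eq_0_iff[of j "f i j"] less_n[of i j] ij by simp
qed (use \<open>t < n\<close> in auto)

lemma threshold:
  assumes "1 < n"
  obtains t where "1 \<le> t" "t < n" "\<And>j. 1 \<le> j \<Longrightarrow> j \<le> t \<Longrightarrow> f 1 j = j - 1"
    "\<And>j. t < j \<Longrightarrow> j < n \<Longrightarrow> f 1 j = j"
proof -
  define T where "T = {j. 1 \<le> j \<and> j < n \<and> f 1 j = j - 1}"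
  have "finite T" unfolding T_def by simp
  have "1 \<in> T" using assms eq_0_iff[of 1 1] by (simp add: T_def)
  \<comment> \<open>Row \<open>1\<close> takes only the values \<open>j - 1\<close> and
    \<open>j\<close> at \<open>j \<ge> 1\<close>; \<open>t\<close> is the last column with the
    former.\<close>
  define t where "t = Max T"
  have "t \<in> T" using \<open>finite T\<close> \<open>1 \<in> T\<close> unfolding t_def by (intro Max_in) auto
  then have t: "1 \<le> t" "t < n" "f 1 t = t - 1" by (auto simp: T_def)
  have lower: "j - 1 \<le> f 1 j" if "1 \<le> j" "j < n" for j
    using growth[of 1 1 j] that by simp
  show thesis
  proof (rule that)
    show "1 \<le> t" "t < n" by fact+
    show "f 1 j = j - 1" if "1 \<le> j" "j \<le> t" for j
      \<comment> \<open>Growth from \<open>j\<close> to \<open>t\<close> forces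
        \<open>f 1 j \<le> j - 1\<close>, since \<open>f 1 t = t - 1\<close>.\<close>
      using growth[of 1 j t] lower[of j] that t by simp
    show "f 1 j = j" if "t < j" "j < n" for j
    proof -
      have "j \<notin> T" using \<open>finite T\<close> that(1) Max_ge[of T j] unfolding t_def by (meson leD)
      then show ?thesis using that t lower[of j] f_le[of 1 j] by (auto simp: T_def)
    qed
  qed
qed

lemma simple_imp_diff:
  assumes "1 < n" "L_simple {..<n} f 0" "i < n" "j < n"
  shows "f i j = j - i"
proof -
  obtain t where t: "1 \<le> t" "t < n" "\<And>j. 1 \<le> j \<Longrightarrow> j \<le> t \<Longrightarrow> f 1 j = j - 1"
    "\<And>j. t < j \<Longrightarrow> j < n \<Longrightarrow> f 1 j = j"
    using threshold[OF assms(1)] by blast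
  have "{..t} = {0} \<or> {..t} = {..<n}"
    using threshold_ideal[OF t(3,4,2)] assms(2) by (simp add: L_simple_def)
  moreover have "{..t} \<noteq> {0}" using t(1) by auto
  ultimately have "j \<le> t" using \<open>j < n\<close> by auto
  \<comment> \<open>For \<open>j < i\<close> both sides are \<open>0\<close>, the right one by
    truncated subtraction.\<close>
  then show ?thesis
    using below_threshold[OF t(3,2), of i j] eq_0_iff[of i j] assms by (cases "i \<le> j") auto
qed

end

text \<open>In a linear algebra this counts the elements strictly above \<open>x\<close>, so it is
  the position of \<open>x\<close> in the descending chain.\<close>

definition chain_index :: "'a set \<Rightarrow> ('a \<Rightarrow> 'a \<Rightarrow> 'a) \<Rightarrow> 'a \<Rightarrow> 'a \<Rightarrow> nat" where
  "chain_index X mul one x = card {y \<in> X. mul y x \<noteq> one}"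

context linear_L_algebra
begin

lemma linear: "x \<in> X \<Longrightarrow> y \<in> X \<Longrightarrow> mul x y = one \<or> mul y x = one"
  using total mul_self by (cases "x = y") (auto simp: totalp_on_def L_le_def)

lemma chain_index_le_iff:
  assumes "finite X" "x \<in> X" "y \<in> X"
  shows "chain_index X mul one y \<le> chain_index X mul one x \<longleftrightarrow> mul x y = one"
proof -
  have mono: "{z \<in> X. mul z b \<noteq> one} \<subseteq> {z \<in> X. mul z a \<noteq> one}"
    if "a \<in> X" "b \<in> X" "mul a b = one" for a b
    using le_trans that by blast
  show ?thesis
  proof
    assume "mul x y = one"
    then show "chain_index X mul one y \<le> chain_index X mul one x"
      unfolding chain_index_def using mono assms by (intro card_mono) auto
  next
    assume le: "chain_index X mul one y \<le> chain_index X mul one x"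
    show "mul x y = one"
    proof (rule ccontr)
      assume neq: "mul x y \<noteq> one"
      then have "mul y x = one" using linear assms by blast
      \<comment> \<open>The inclusion is strict because \<open>x\<close> lies in the right-hand set
        only.\<close>
      then have "{z \<in> X. mul z x \<noteq> one} \<subset> {z \<in> X. mul z y \<noteq> one}"
        using mono[of y x] neq assms mul_self[of x] by blast
      then have "chain_index X mul one x < chain_index X mul one y"
        unfolding chain_index_def using assms by (intro psubset_card_mono) auto
      with le show False by simp
    qed
  qed
qed

lemma chain_index_one: "chain_index X mul one one = 0"
  unfolding chain_index_def using mul_one by (auto simp: card_eq_0_iff)

lemma bij_chain_index:
  assumes "finite X"
  shows "bij_betw (chain_index X mul one) X {..<card X}"
proof -
  have inj: "inj_on (chain_index X mul one) X"
    using chain_index_le_iff[OF assms] antisym by (intro inj_onI) (metis order_refl)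
  \<comment> \<open>The element \<open>x\<close> itself is never counted, as
    \<open>mul x x = one\<close>.\<close>
  have "chain_index X mul one x < card X" if "x \<in> X" for x
    unfolding chain_index_def using assms that mul_self by (intro psubset_card_mono) auto
  then have "chain_index X mul one ` X \<subseteq> {..<card X}" by auto
  then have "chain_index X mul one ` X = {..<card X}"
    using inj by (intro card_subset_eq) (auto simp: card_image)
  with inj show ?thesis by (simp add: bij_betw_def)
qed

end

theorem theorem4p8:
  fixes X :: "'a set" and mul :: "'a \<Rightarrow> 'a \<Rightarrow> 'a" and one :: 'a and n :: nat
  assumes "n > 1"
    and "linear_L_algebra X mul one"
    and "card X = n"
    and "L_simple X mul one"
  shows "L_isomorphic X mul one (A_carrier n) A_mul 0"
proof -
  interpret linear_L_algebra X mul one by fact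
  have "finite X" using assms(1,3) by (intro card_ge_0_finite) simp
  define h where "h = chain_index X mul one"
  define g where "g = inv_into X h"
  \<comment> \<open>This is the operation of \<open>X\<close> carried over to indices along the
    bijection \<open>h\<close> with inverse \<open>g\<close>.\<close>
  define f where "f i j = h (mul (g i) (g j))" for i j
  have bij: "bij_betw h X {..<n}"
    using bij_chain_index[OF \<open>finite X\<close>] assms(3) by (simp add: h_def)
  have gh [simp]: "g (h x) = x" if "x \<in> X" for x
    using bij that unfolding g_def by (simp add: bij_betw_def)
  have hg [simp]: "h (g i) = i" if "i < n" for i
    using bij that unfolding g_def by (simp add: bij_betw_def f_inv_into_f)
  have gX [simp]: "g i \<in> X" if "i < n" for i
    using bij that unfolding g_def by (simp add: bij_betw_def inv_into_into)
  have hn [simp]: "h x < n" if "x \<in> X" for x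
    using bij that by (auto simp: bij_betw_def)
  have h_one: "h one = 0" by (simp add: h_def chain_index_one)
  then have g_0: "g 0 = one" using gh[OF one_closed] by simp
  have h_eq_0: "h x = 0 \<longleftrightarrow> x = one" if "x \<in> X" for x
    using gh[OF that] g_0 h_one by auto
  have f_eq_0: "f i j = 0 \<longleftrightarrow> j \<le> i" if "i < n" "j < n" for i j
    using chain_index_le_iff[OF \<open>finite X\<close>, of "g i" "g j"] that
    by (simp add: f_def h_eq_0 mul_closed flip: h_def)
  interpret chain: chain_L_algebra n f
  proof
    fix i j k assume "i \<in> {..<n}" "j \<in> {..<n}" "k \<in> {..<n}"
    then show "f (f i j) (f i k) = f (f j i) (f j k)"
      by (simp add: f_def mul_closed cycloid)
  \<comment> \<open>Antisymmetry of the copy comes from that of the order on numbers, through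
    \<open>f_eq_0\<close>.\<close>
  qed (use \<open>n > 1\<close> f_eq_0 in \<open>auto simp: mul_closed f_def g_0 one_mul mul_one mul_self h_one\<close>)
  have hom: "h (mul x y) = f (h x) (h y)" if "x \<in> X" "y \<in> X" for x y
    using that by (simp add: f_def)
  have "L_simple {..<n} f (h one)"
    using bij mul_closed hom assms(4) by (rule L_simple_image)
  then have "f i j = j - i" if "i < n" "j < n" for i j
    using chain.simple_imp_diff assms(1) that by (simp add: h_one)
  then show ?thesis
    unfolding L_isomorphic_def A_carrier_def A_mul_def
    using bij h_one hom by (intro exI[of _ h]) simp
qed

end
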